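(* Let $n\ge 3$, let $(\mathbf d,\mathbf r)$ with $\mathbf r=(r_1,\dots,r_n)$ be an arithmetical structure on the cycle graph $C_n$, and let $p=\operatorname{lcm}\{r_i:1\le i\le n\}$. Let $\tilde r_0$ be a positive integer such that $p$ divides $\tilde r_0$ and $\tilde r_0$ divides $\sum_{i=1}^n r_i$, and put $\tilde{\mathbf r}=(\tilde r_0,r_1,\dots,r_n)$. Then $\tilde{\mathbf r}$ is an $\mathbf r$-structure on the wheel graph $W_n$.
   Context: $\mathbb N$ denotes the positive integers. For a finite connected simple graph $G$ with vertex set $V$ and adjacency matrix $A$, an arithmetical structure on $G$ is a pair $(\mathbf d,\mathbf r)\in\mathbb N^V\times\mathbb N^V$ such that the gcd of the entries of $\mathbf r$ is $1$ and $(\operatorname{diag}(\mathbf d)-A)\mathbf r=0$, i.e. $d_vr_v=\sum_{u\sim v}r_u$ for every vertex $v$. A vector $\mathbf r\in\mathbb N^V$ is called an $\mathbf r$-structure on $G$ if there is $\mathbf d\in\mathbb N^V$ such that $(\mathbf d,\mathbf r)$ is an arithmetical structure on $G$. The cycle $C_n$ ($n\ge3$) has vertices $v_1,\dots,v_n$ with $v_i$ adjacent to $v_{i+1}$ (indices mod $n$). The wheel graph $W_n$ is obtained from $C_n$ by adding a central vertex $v_0$ adjacent to all of $v_1,\dots,v_n$. Entries with index $i$ belong to $v_i$ (the first entry of $\tilde{\mathbf r}$ belongs to $v_0$). *)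

theory Defs
  imports "Graph_Theory.Graph_Theory"
begin

text \<open>
  A simple graph is a symmetric loop-free digraph without parallel arcs
  (\<^locale>\<open>pair_graph\<close>, which also includes finiteness): an edge joining u and v is the pair of
  arcs (u, v), (v, u).

  The vertex \<open>v\<^sub>i\<close> of a cycle or wheel is the number i. Values of d and r outside the vertex set
  play no role.
\<close>

definition arithmetical_structure ::
    "'a pair_pre_digraph \<Rightarrow> ('a \<Rightarrow> nat) \<Rightarrow> ('a \<Rightarrow> nat) \<Rightarrow> bool" where
  "arithmetical_structure G d r \<longleftrightarrow>
     pair_graph G \<and> connected (with_proj G) \<and>
     (\<forall>v \<in> pverts G. 0 < d v \<and> 0 < r v) \<and>
     Gcd (r ` pverts G) = 1 \<and>
     (\<forall>v \<in> pverts G. d v * r v = (\<Sum>u | (u, v) \<in> parcs G. r u))"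

definition r_structure :: "'a pair_pre_digraph \<Rightarrow> ('a \<Rightarrow> nat) \<Rightarrow> bool" where
  "r_structure G r \<longleftrightarrow> (\<exists>d. arithmetical_structure G d r)"

text \<open>The cyclic successor of i in 1, ..., n is i mod n + 1. The two graphs below are the usual
  (simple) cycle and wheel for n at least 3.\<close>

definition cycle_graph :: "nat \<Rightarrow> nat pair_pre_digraph" where
  "cycle_graph n =
     \<lparr> pverts = {1..n},
       parcs = {(i, j). i \<in> {1..n} \<and> j \<in> {1..n} \<and> (j = i mod n + 1 \<or> i = j mod n + 1)} \<rparr>"

definition wheel_graph :: "nat \<Rightarrow> nat pair_pre_digraph" where
  "wheel_graph n =
     \<lparr> pverts = insert 0 (pverts (cycle_graph n)),
       parcs = parcs (cycle_graph n) \<union> {0} \<times> {1..n} \<union> {1..n} \<times> {0} \<rparr>"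

lemma pair_graph_cycle_graph:
  assumes "n \<ge> 3"
  shows "pair_graph (cycle_graph n)"
proof
  show "finite (parcs (cycle_graph n))"
    by (rule finite_subset[of _ "{1..n} \<times> {1..n}"]) (auto simp: cycle_graph_def)
  have *: "i mod n + 1 \<noteq> i" if "i \<le> n" for i
    using that assms by (cases "i = n") auto
  show "fst e \<noteq> snd e" if "e \<in> parcs (cycle_graph n)" for e
    using that *[of "fst e"] by (auto simp: cycle_graph_def)
qed (auto simp: cycle_graph_def symmetric_def sym_def)

lemma pair_graph_wheel_graph:
  assumes "n \<ge> 3"
  shows "pair_graph (wheel_graph n)"
proof -
  interpret C: pair_graph "cycle_graph n" by (rule pair_graph_cycle_graph[OF assms])
  have V: "pverts (cycle_graph n) = {1..n}" by (simp add: cycle_graph_def)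
  show ?thesis
  proof
    show "fst e \<noteq> snd e" if "e \<in> parcs (wheel_graph n)" for e
      using that C.pair_no_loops[of e] by (auto simp: wheel_graph_def)
    show "symmetric (with_proj (wheel_graph n))"
      using C.pair_sym_arcs by (auto simp: wheel_graph_def symmetric_def sym_def)
  qed (use C.pair_finite_arcs V in
    \<open>auto simp: wheel_graph_def dest: C.arc_fst_in_verts C.arc_snd_in_verts\<close>)
qed

lemma (in pair_graph) connected_from_root:
  assumes "z \<in> pverts G" and "\<And>v. v \<in> pverts G \<Longrightarrow> z \<rightarrow>\<^sup>*\<^bsub>with_proj G\<^esub> v"
  shows "connected (with_proj G)"
proof -
  have "u \<rightarrow>\<^sup>*\<^bsub>with_proj G\<^esub> v" if "u \<in> pverts G" "v \<in> pverts G" for u v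
    using that assms(2) symmetric_reachable[OF pair_sym_arcs] reachable_trans by blast
  then show ?thesis
    using assms(1) by (intro connectedI) (auto simp: reachable_mk_symmetric_eq[OF pair_sym_arcs])
qed

lemma connected_cycle_graph:
  assumes "n \<ge> 3"
  shows "connected (with_proj (cycle_graph n))"
proof -
  interpret pair_graph "cycle_graph n" by (rule pair_graph_cycle_graph[OF assms])
  have "1 \<rightarrow>\<^sup>*\<^bsub>with_proj (cycle_graph n)\<^esub> v" if "1 \<le> v" "v \<le> n" for v
    using that
  proof (induction v rule: nat_induct_at_least)
    case base
    then have "1 \<in> pverts (cycle_graph n)" by (simp add: cycle_graph_def)
    then show ?case by (rule reachable_refl)
  next
    case (Suc v)
    then have "(v, Suc v) \<in> parcs (cycle_graph n)" by (auto simp: cycle_graph_def)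
    then have "v \<rightarrow>\<^sup>*\<^bsub>with_proj (cycle_graph n)\<^esub> Suc v" by (intro reachable_adjI) simp
    with Suc show ?case using reachable_trans by auto
  qed
  then show ?thesis
    using assms by (intro connected_from_root[of 1]) (auto simp: cycle_graph_def)
qed

lemma connected_wheel_graph:
  assumes "n \<ge> 3"
  shows "connected (with_proj (wheel_graph n))"
proof -
  interpret pair_graph "wheel_graph n" by (rule pair_graph_wheel_graph[OF assms])
  have "0 \<rightarrow>\<^sup>*\<^bsub>with_proj (wheel_graph n)\<^esub> v" if "v \<in> pverts (wheel_graph n)" for v
  proof (cases "v = 0")
    case True
    then show ?thesis using that by (auto intro!: reachable_refl)
  next
    case False
    then have "(0, v) \<in> parcs (wheel_graph n)"
      using that by (auto simp: wheel_graph_def cycle_graph_def)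
    then show ?thesis by (intro reachable_adjI) simp
  qed
  then show ?thesis
    by (intro connected_from_root[of 0]) (auto simp: wheel_graph_def)
qed

end

theory Submission
  imports Defs
begin

text \<open>
  Joining the hub to every rim vertex changes the equation at a rim vertex \<open>v\<^sub>i\<close> only by the new
  summand \<open>r\<^sub>0\<close>. Since \<open>r\<^sub>i\<close> divides \<open>r\<^sub>0\<close> (it divides the lcm of the rim entries), raising \<open>d\<^sub>i\<close> by
  \<open>r\<^sub>0 / r\<^sub>i\<close> restores the balance. The hub sees every rim vertex once, so its equation can
  be solved for a positive integer \<open>d\<^sub>0\<close> exactly when \<open>r\<^sub>0\<close> divides the sum of the rim entries. The gcd stays 1 because
  the rim entries alone already have gcd 1.
\<close>

lemma in_neighbours_wheel_hub: "{u. (u, 0) \<in> parcs (wheel_graph n)} = {1..n}"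
  by (auto simp: wheel_graph_def cycle_graph_def)

lemma in_neighbours_wheel_rim:
  assumes "v \<in> {1..n}"
  shows "{u. (u, v) \<in> parcs (wheel_graph n)} = insert 0 {u. (u, v) \<in> parcs (cycle_graph n)}"
  using assms by (auto simp: wheel_graph_def)

lemma sum_in_neighbours_wheel_rim:
  fixes r :: "nat \<Rightarrow> nat"
  assumes "v \<in> {1..n}"
  shows "(\<Sum>u | (u, v) \<in> parcs (wheel_graph n). (r(0 := r0)) u) =
    r0 + (\<Sum>u | (u, v) \<in> parcs (cycle_graph n). r u)"
proof -
  let ?N = "{u. (u, v) \<in> parcs (cycle_graph n)}"
  have "?N \<subseteq> {1..n}"
    by (auto simp: cycle_graph_def)
  then have "finite ?N" and hub: "0 \<notin> ?N"
    by (auto intro: finite_subset)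
  moreover have "(\<Sum>u\<in>?N. (r(0 := r0)) u) = (\<Sum>u\<in>?N. r u)"
    using hub by (intro sum.cong) auto
  ultimately show ?thesis
    unfolding in_neighbours_wheel_rim[OF assms] by simp
qed

theorem theorem3p9:
  fixes n p r0 :: nat and d r :: "nat \<Rightarrow> nat"
  assumes "n \<ge> 3"
    and "arithmetical_structure (cycle_graph n) d r"
    and "p = Lcm {r i | i. 1 \<le> i \<and> i \<le> n}"
    and "0 < r0"
    and "p dvd r0"
    and "r0 dvd (\<Sum>i = 1..n. r i)"
  shows "r_structure (wheel_graph n) (r(0 := r0))"
proof -
  let ?r = "r(0 := r0)"
  define d' where
    "d' v = (if v = 0 then (\<Sum>i = 1..n. r i) div r0 else d v + r0 div r v)" for v
  have rim: "pverts (cycle_graph n) = {1..n}"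
    and verts: "pverts (wheel_graph n) = insert 0 {1..n}"
    by (simp_all add: wheel_graph_def cycle_graph_def)
  have pos: "0 < d v" "0 < r v" if "v \<in> {1..n}" for v
    using assms(2) that by (auto simp: arithmetical_structure_def rim)
  have balance: "d v * r v = (\<Sum>u | (u, v) \<in> parcs (cycle_graph n). r u)" if "v \<in> {1..n}" for v
    using assms(2) that unfolding arithmetical_structure_def rim by blast
  have r_dvd: "r v dvd r0" if "v \<in> {1..n}" for v
  proof -
    have "r v dvd p"
      unfolding assms(3) using that by (intro dvd_Lcm) auto
    then show ?thesis
      using assms(5) by (rule dvd_trans)
  qed
  have sum_pos: "0 < (\<Sum>i = 1..n. r i)"
    using assms(1) pos(2) by (intro sum_pos) auto
  have "0 < d' v \<and> 0 < ?r v" if "v \<in> pverts (wheel_graph n)" for v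
    using that pos[of v] assms(4) sum_pos dvd_imp_le[OF assms(6)]
    by (auto simp: verts d'_def div_greater_zero_iff)
  moreover have "Gcd (?r ` pverts (wheel_graph n)) = 1"
  proof -
    have "?r ` {1..n} = r ` {1..n}"
      by (intro image_cong) auto
    then have "Gcd (?r ` {1..n}) = 1"
      using assms(2) by (simp only: arithmetical_structure_def rim)
    then show ?thesis
      unfolding verts image_insert Gcd_insert by simp
  qed
  moreover have "d' v * ?r v = (\<Sum>u | (u, v) \<in> parcs (wheel_graph n). ?r u)"
    if v: "v \<in> pverts (wheel_graph n)" for v
  proof (cases "v = 0")
    case True
    have "(\<Sum>i = 1..n. ?r i) = (\<Sum>i = 1..n. r i)"
      by (intro sum.cong) auto
    then show ?thesis
      unfolding True in_neighbours_wheel_hub using assms(6) by (simp add: d'_def)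
  next
    case False
    then have "v \<in> {1..n}"
      using v by (simp add: verts)
    then show ?thesis
      unfolding sum_in_neighbours_wheel_rim[OF \<open>v \<in> {1..n}\<close>] balance[symmetric, OF \<open>v \<in> {1..n}\<close>]
      using False r_dvd[OF \<open>v \<in> {1..n}\<close>] by (simp add: d'_def algebra_simps)
  qed
  ultimately have "arithmetical_structure (wheel_graph n) d' ?r"
    unfolding arithmetical_structure_def
    using pair_graph_wheel_graph[OF assms(1)] connected_wheel_graph[OF assms(1)] by blast
  then show ?thesis
    unfolding r_structure_def by blast
qed

end
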